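(* Let $a_1,a_2,b_1,b_2>0$. For all integers $n_1,n_2\ge 0$, the multiple Charlier polynomials $C_{n_1,n_2}^{(a_1,a_2)}(x)$ and $C_{n_1,n_2}^{(b_1,b_2)}(x)$ fulfill the connection formula $$C_{n_1,n_2}^{(b_1,b_2)}(x)=\sum_{k=0}^{n_1}\sum_{\ell=0}^{n_2}\binom{n_1}{k}\binom{n_2}{\ell}(a_1-b_1)^k(a_2-b_2)^\ell\, C^{(a_1,a_2)}_{n_1-k,n_2-\ell}(x).$$
   Context: For an integer $n\ge 0$, $x^{(n,1)}=x(x-1)\cdots(x-n+1)$ denotes the falling factorial, with $x^{(0,1)}=1$. For parameters $a_1,a_2>0$ and integers $n_1,n_2\ge 0$, the multiple Charlier polynomials (for $r=2$ weights $a_i^x/\Gamma(x+1)$, $x=0,1,2,\ldots$) are given by $$C_{n_1,n_2}^{(a_1,a_2)}(x)=\sum_{k=0}^{n_1}\sum_{\ell=0}^{n_2}\binom{n_1}{k}\binom{n_2}{\ell}(-a_1)^{n_1-k}(-a_2)^{n_2-\ell}\,x^{(k+\ell,1)}.$$ The convention $0^0=1$ is used. *)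

theory Defs
  imports Complex_Main "HOL-Computational_Algebra.Polynomial"
begin

text \<open>The falling factorial \<open>x (x - 1) \<dots> (x - n + 1)\<close> as a polynomial in \<open>x\<close>.\<close>

definition falling_factorial :: "nat \<Rightarrow> real poly" where
  "falling_factorial n = (\<Prod>i<n. [:- of_nat i, 1:])"

definition multiple_charlier :: "real \<Rightarrow> real \<Rightarrow> nat \<Rightarrow> nat \<Rightarrow> real poly" where
  "multiple_charlier a1 a2 n1 n2 =
     (\<Sum>k\<le>n1. \<Sum>l\<le>n2.
        smult (of_nat (n1 choose k) * of_nat (n2 choose l) * (- a1) ^ (n1 - k) * (- a2) ^ (n2 - l))
          (falling_factorial (k + l)))"

lemma poly_falling_factorial:
  "poly (falling_factorial n) x = (\<Prod>i<n. x - of_nat i)"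
  by (simp add: falling_factorial_def poly_prod)

lemma poly_multiple_charlier:
  "poly (multiple_charlier a1 a2 n1 n2) x =
     (\<Sum>k\<le>n1. \<Sum>l\<le>n2.
        of_nat (n1 choose k) * of_nat (n2 choose l) * (- a1) ^ (n1 - k) * (- a2) ^ (n2 - l) *
          (\<Prod>i<k + l. x - of_nat i))"
  by (simp add: multiple_charlier_def poly_sum poly_falling_factorial)

end

theory Submission
  imports Defs
begin

text \<open>In each index separately, the polynomials arise from the falling factorials by a binomial
  transform with parameter \<open>-a\<close>. Binomial transforms with parameters \<open>c\<close> and \<open>d\<close> compose to the
  one with parameter \<open>c + d\<close>, and \<open>(a - b) + (-a) = -b\<close>.\<close>

lemma smult_sum_right:
  "smult c (sum f A) = (\<Sum>i\<in>A. smult c (f i))"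
  by (induction A rule: infinite_finite_induct) (auto simp: smult_add_right)

definition binomial_transform ::
    "'a::comm_semiring_1 \<Rightarrow> (nat \<Rightarrow> 'a poly) \<Rightarrow> nat \<Rightarrow> 'a poly" where
  "binomial_transform d F n = (\<Sum>j\<le>n. smult (of_nat (n choose j) * d ^ (n - j)) (F j))"

text \<open>Once the triangular double sum is reordered, the coefficient of \<open>F j\<close>
  contains \<open>(c + d) ^ (n - j)\<close> expanded by the binomial theorem.\<close>

lemma binomial_transform_add:
  "binomial_transform (c + d) F n =
    (\<Sum>k\<le>n. smult (of_nat (n choose k) * c ^ k) (binomial_transform d F (n - k)))"
proof -
  define g where "g k j = smult (of_nat (n choose k) * c ^ k *
      (of_nat ((n - k) choose j) * d ^ (n - k - j))) (F j)" for k j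
  \<comment> \<open>Both products equal \<open>n! / (j! k! (n - j - k)!)\<close>; the link is to
    choose \<open>k + j\<close> elements first and then split them.\<close>
  have choose: "(n choose k) * ((n - k) choose j) = (n choose j) * ((n - j) choose k)"
    if "j \<le> n" "k \<le> n - j" for j k
  proof -
    have "(n choose k) * ((n - k) choose j) = (n choose (k + j)) * ((k + j) choose k)"
      using that choose_mult[of k "k + j" n] by simp
    also have "\<dots> = (n choose (k + j)) * ((k + j) choose j)"
      using binomial_symmetric[of k "k + j"] by simp
    also have "\<dots> = (n choose j) * ((n - j) choose k)"
      using that choose_mult[of j "k + j" n] by simp
    finally show ?thesis .
  qed
  have "(\<Sum>k\<le>n. smult (of_nat (n choose k) * c ^ k) (binomial_transform d F (n - k)))
      = (\<Sum>k\<le>n. \<Sum>j\<le>n - k. g k j)"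
    by (simp add: binomial_transform_def g_def smult_sum_right)
  also have "\<dots> = (\<Sum>j\<le>n. \<Sum>k\<le>n - j. g k j)"
    \<comment> \<open>Both index sets describe the triangle \<open>k + j \<le> n\<close>, which
      swapping coordinates preserves.\<close>
    by (simp add: sum.Sigma, rule sum.reindex_bij_witness[of _ prod.swap prod.swap]) auto
  also have "\<dots> = (\<Sum>j\<le>n. smult (of_nat (n choose j) * (c + d) ^ (n - j)) (F j))"
  proof (rule sum.cong[OF refl])
    fix j assume "j \<in> {..n}"
    then have "g k j = smult (of_nat (n choose j) *
        (of_nat ((n - j) choose k) * c ^ k * d ^ (n - j - k))) (F j)" if "k \<le> n - j" for k
      using arg_cong[OF choose[of j k], of "of_nat :: nat \<Rightarrow> 'a"] that
      by (simp add: g_def add.commute mult_ac) (simp flip: mult.assoc)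
    then show "(\<Sum>k\<le>n - j. g k j) = smult (of_nat (n choose j) * (c + d) ^ (n - j)) (F j)"
      by (simp add: binomial_ring sum_distrib_left smult_sum)
  qed
  finally show ?thesis
    by (simp add: binomial_transform_def)
qed

text \<open>The weights split into a factor in \<open>k\<close> and a factor in \<open>l\<close>, so
  the double sum is an iterated transform; only \<open>falling_factorial (k + l)\<close> couples the
  indices.\<close>

lemma multiple_charlier_eq_binomial_transform:
  "multiple_charlier a1 a2 n1 n2 =
    binomial_transform (- a1) (\<lambda>k. binomial_transform (- a2) (\<lambda>l. falling_factorial (k + l)) n2) n1"
  by (simp add: multiple_charlier_def binomial_transform_def smult_sum_right mult_ac)

text \<open>The transform is linear in the sequence. This moves the sum from expanding the inner
  transform out of the outer one.\<close>

lemma binomial_transform_sum_smult: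
  "binomial_transform d (\<lambda>j. \<Sum>l\<in>A. smult (w l) (F l j)) n =
    (\<Sum>l\<in>A. smult (w l) (binomial_transform d (F l) n))"
  unfolding binomial_transform_def smult_sum_right
  by (subst sum.swap) (simp add: mult_ac)

theorem theorem4:
  fixes a1 a2 b1 b2 :: real and n1 n2 :: nat
  assumes "a1 > 0" and "a2 > 0" and "b1 > 0" and "b2 > 0"
  shows "multiple_charlier b1 b2 n1 n2 =
    (\<Sum>k\<le>n1. \<Sum>l\<le>n2.
       smult (of_nat (n1 choose k) * of_nat (n2 choose l) * (a1 - b1) ^ k * (a2 - b2) ^ l)
         (multiple_charlier a1 a2 (n1 - k) (n2 - l)))"
proof -
  have b1: "- b1 = (a1 - b1) + - a1" and b2: "- b2 = (a2 - b2) + - a2"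
    by simp_all
  show ?thesis
    unfolding multiple_charlier_eq_binomial_transform b1 b2 binomial_transform_add
      binomial_transform_sum_smult
    \<comment> \<open>By linearity \<open>l\<close> has become the outer index on the left, so the
      sums on the right are swapped to match.\<close>
    by (subst sum.swap) (simp add: smult_sum_right mult_ac)
qed

end
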